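(* Let $m=p^s$ be a prime power with $p$ prime and $s\geq 2$, and let $k=p^{s-1}+1$. Then there exist constants $C_m>0$ and $0< c_m \leq m/2$ (depending only on $m$) such that for all integers $n\ge 1$ $$r_k(\mathbb{Z}_m^n)\geq C_m \frac{(m-p+1)^n}{n^{c_m}}.$$
   Context: $\mathbb{Z}_m^n$ denotes the additive group $(\mathbb{Z}/m\mathbb{Z})^n$. A proper arithmetic progression of length $k$ in $\mathbb{Z}_m^n$ is a sequence $x, x+d, \ldots, x+(k-1)d$ (with $x,d\in\mathbb{Z}_m^n$) whose $k$ elements are pairwise distinct. $r_k(\mathbb{Z}_m^n)$ denotes the maximal size of a set $S\subseteq\mathbb{Z}_m^n$ that does not contain a proper arithmetic progression of length $k$. *)

theory Defs
  imports Complex_Main "HOL-Computational_Algebra.Primes" "HOL-Algebra.Product_Groups"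
begin

definition ZM_pow :: "nat \<Rightarrow> nat \<Rightarrow> (nat \<Rightarrow> int) monoid" where
  "ZM_pow m n = product_group {..<n} (\<lambda>_. integer_mod_group m)"

text \<open>Groups are written multiplicatively in HOL-Algebra, so
  \<open>ap_term G x d i\<close> is the term \<open>x + i d\<close> of a progression.\<close>

definition ap_term :: "('a, 'b) monoid_scheme \<Rightarrow> 'a \<Rightarrow> 'a \<Rightarrow> nat \<Rightarrow> 'a" where
  "ap_term G x d i = x \<otimes>\<^bsub>G\<^esub> (d [^]\<^bsub>G\<^esub> i)"

definition contains_proper_ap :: "('a, 'b) monoid_scheme \<Rightarrow> nat \<Rightarrow> 'a set \<Rightarrow> bool" where
  "contains_proper_ap G k S \<longleftrightarrow>
     (\<exists>x\<in>carrier G. \<exists>d\<in>carrier G.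
        inj_on (ap_term G x d) {..<k} \<and> ap_term G x d ` {..<k} \<subseteq> S)"

text \<open>Meaningful for a finite carrier and \<open>k > 0\<close>; then the maximum is over a finite set that
  is nonempty, because the empty set contains no progression.\<close>

definition r_ap :: "nat \<Rightarrow> ('a, 'b) monoid_scheme \<Rightarrow> nat" where
  "r_ap k G = Max {card S | S. S \<subseteq> carrier G \<and> \<not> contains_proper_ap G k S}"

end

theory Submission
  imports Defs "HOL-Number_Theory.Cong"
begin

text \<open>Let \<open>q = p ^ (s - 1)\<close> and let \<open>D\<close> consist of the residues modulo \<open>m = p ^ s\<close> that are not
  nonzero multiples of \<open>q\<close>, so that \<open>D\<close> has \<open>m - p + 1\<close> elements. Consider a progression
  \<open>x + i d\<close>, \<open>0 \<le> i \<le> q\<close>, inside \<open>D\<^sup>n\<close>. If \<open>x\<^sub>j = 0\<close> then \<open>d\<^sub>j = 0\<close>, as otherwise some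
  \<open>i d\<^sub>j\<close> would be a nonzero multiple of \<open>q\<close>; so every term vanishes wherever \<open>x\<close> does. If the
  progression is proper then its terms with \<open>i = 0\<close> and \<open>i = q\<close> differ, so some \<open>d\<^sub>j\<close> is a unit;
  then \<open>x\<^sub>j + i d\<^sub>j\<close> is a multiple of \<open>q\<close>, hence zero, for some \<open>i < q\<close>, and this term has more zeros
  than \<open>x\<close>. So the vectors in \<open>D\<^sup>n\<close> with a prescribed number of zeros contain no proper progression,
  and one of the \<open>n + 1\<close> possible numbers accounts for at least \<open>(m - p + 1)\<^sup>n / (n + 1)\<close> vectors.
  This gives the exponent \<open>1 \<le> m / 2\<close>.\<close>

definition digits :: "nat \<Rightarrow> nat \<Rightarrow> int set" where
  "digits p r = {a \<in> {0..<int (p ^ Suc r)}. int (p ^ r) dvd a \<longrightarrow> a = 0}"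

definition digit_vectors :: "nat \<Rightarrow> nat \<Rightarrow> nat \<Rightarrow> (nat \<Rightarrow> int) set" where
  "digit_vectors p r n = (\<Pi>\<^sub>E j\<in>{..<n}. digits p r)"

definition zero_set :: "nat \<Rightarrow> (nat \<Rightarrow> int) \<Rightarrow> nat set" where
  "zero_set n x = {j. j < n \<and> x j = 0}"

lemma finite_digits [simp]: "finite (digits p r)"
  by (rule finite_subset[of _ "{0..<int (p ^ Suc r)}"]) (auto simp: digits_def)

text \<open>With \<open>r\<close> in the role of \<open>s - 1\<close>, the deleted residues are
  exactly \<open>p ^ r * t\<close> for \<open>1 \<le> t < p\<close>.\<close>

lemma card_digits:
  assumes "p > 0"
  shows "card (digits p r) = p ^ Suc r - (p - 1)"
proof -
  let ?q = "int (p ^ r)"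
  let ?M = "(\<lambda>t. ?q * t) ` {1..<int p}"
  have q: "?q > 0"
    using assms by simp
  have "digits p r = {0..<int (p ^ Suc r)} - ?M"
  proof (intro equalityI subsetI)
    fix a assume a: "a \<in> digits p r"
    then show "a \<in> {0..<int (p ^ Suc r)} - ?M"
      using q by (auto simp: digits_def)
  next
    fix a assume a: "a \<in> {0..<int (p ^ Suc r)} - ?M"
    have "a = 0" if dvd: "?q dvd a"
    proof (rule ccontr)
      assume "a \<noteq> 0"
      obtain t where t: "a = ?q * t"
        using dvd by blast
      have "0 < ?q * t" "?q * t < ?q * int p"
        using a t \<open>a \<noteq> 0\<close> by (auto simp: mult.commute)
      then have "0 < t" "t < int p"
        using q by (simp_all only: zero_less_mult_pos mult_less_cancel_left_pos)
      then show False
        using a t by auto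
    qed
    then show "a \<in> digits p r"
      using a by (simp add: digits_def)
  qed
  moreover have "?M \<subseteq> {0..<int (p ^ Suc r)}"
    using q by (auto simp: mult.commute)
  moreover have "card ?M = p - 1"
    using q by (subst card_image) (auto simp: inj_on_def)
  ultimately show ?thesis
    by (simp add: card_Diff_subset nat_mult_distrib nat_power_eq)
qed

text \<open>If \<open>p ^ t\<close> is the exact power of \<open>p\<close> dividing
  \<open>d\<close>, then \<open>t \<le> r\<close>, and the multiplier \<open>p ^ (r - t)\<close>
  raises the valuation to exactly \<open>r\<close>. The bound \<open>p ^ r\<close> is attained when
  \<open>t = 0\<close>, which is why progressions need \<open>p ^ r + 1\<close> terms.\<close>

lemma exists_multiple_in_deleted_class:
  fixes d :: int
  assumes p: "prime p" and d: "\<not> int (p ^ Suc r) dvd d"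
  shows "\<exists>i\<le>p ^ r. int (p ^ r) dvd int i * d \<and> \<not> int (p ^ Suc r) dvd int i * d"
proof -
  have P: "prime (int p)" using p by simp
  have "d \<noteq> 0" using d by auto
  then obtain y where y: "d = int p ^ multiplicity (int p) d * y" "\<not> int p dvd y"
    using P by (metis multiplicity_decompose' not_prime_unit)
  define t where "t = multiplicity (int p) d"
  have "t \<le> r"
  proof (rule ccontr)
    assume "\<not> t \<le> r"
    then have "int p ^ Suc r dvd int p ^ t"
      by (intro le_imp_power_dvd) simp
    then show False
      using d y(1) unfolding t_def by (metis dvd_mult2 of_nat_power)
  qed
  then have *: "int (p ^ (r - t)) * d = int p ^ r * y"
    using y(1) unfolding t_def[symmetric]
    by (metis le_add_diff_inverse2 mult.assoc of_nat_power power_add)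
  show ?thesis
  proof (intro exI conjI)
    show "p ^ (r - t) \<le> p ^ r"
      using p by (intro power_increasing) (simp_all add: prime_ge_1_nat del: One_nat_def)
    show "int (p ^ r) dvd int (p ^ (r - t)) * d"
      unfolding * by simp
    show "\<not> int (p ^ Suc r) dvd int (p ^ (r - t)) * d"
      unfolding * using y(2) p by (auto simp: mult.commute[of "int p"])
  qed
qed

text \<open>Since \<open>d\<close> is invertible modulo \<open>p ^ r\<close>, the congruence
  \<open>x + i d = 0\<close> can be solved for \<open>i\<close>, and its least nonnegative solution
  is below \<open>p ^ r\<close>.\<close>

lemma exists_term_dvd:
  fixes d x :: int
  assumes p: "prime p" and d: "\<not> int p dvd d"
  shows "\<exists>i<p ^ r. int (p ^ r) dvd x + int i * d"
proof -
  let ?q = "int (p ^ r)"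
  have q: "?q > 0" using prime_gt_0_nat[OF p] by simp
  have "coprime (int p) d"
    using p d by (intro prime_imp_coprime) auto
  then have "coprime d ?q"
    by (simp add: coprime_commute)
  then obtain e where e: "[d * e = 1] (mod ?q)"
    using cong_solve_coprime_int by blast
  define i where "i = nat ((- x * e) mod ?q)"
  have i: "int i = (- x * e) mod ?q"
    using q by (simp add: i_def)
  then have "[int i * d = - x * e * d] (mod ?q)"
    by (simp only: cong_def mod_mult_left_eq)
  also have "- x * e * d = - x * (d * e)"
    by (simp add: ac_simps)
  also have "[- x * (d * e) = - x * 1] (mod ?q)"
    using e by (rule cong_scalar_left)
  finally have "?q dvd x + int i * d"
    by (simp add: cong_iff_dvd_diff algebra_simps)
  moreover have "i < p ^ r"
    using q i by (metis of_nat_less_iff pos_mod_bound)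
  ultimately show ?thesis by blast
qed

text \<open>Reducing each coordinate once, at the end, turns questions about terms into divisibility
  over the integers.\<close>

lemma ap_term_ZM_pow:
  "ap_term (ZM_pow m n) x d i = (\<lambda>j\<in>{..<n}. (x j + int i * d j) mod int m)"
proof -
  have "d [^]\<^bsub>ZM_pow m n\<^esub> i = (\<lambda>j\<in>{..<n}. (int i * d j) mod int m)"
    by (induction i) (auto simp: ZM_pow_def restrict_def fun_eq_iff nat_pow_def
        product_group_def algebra_simps mod_simps)
  then show ?thesis
    by (auto simp: ap_term_def ZM_pow_def fun_eq_iff mod_simps)
qed

lemma no_proper_ap_constant_zero_count:
  assumes p: "prime p"
  shows "\<not> contains_proper_ap (ZM_pow (p ^ Suc r) n) (p ^ r + 1)
            {x \<in> digit_vectors p r n. card (zero_set n x) = N}"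
proof
  let ?m = "int (p ^ Suc r)" and ?q = "int (p ^ r)"
  let ?G = "ZM_pow (p ^ Suc r) n"
  let ?S = "{x \<in> digit_vectors p r n. card (zero_set n x) = N}"
  assume "contains_proper_ap ?G (p ^ r + 1) ?S"
  then obtain x d where
    inj: "inj_on (ap_term ?G x d) {..<p ^ r + 1}" and
    sub: "ap_term ?G x d ` {..<p ^ r + 1} \<subseteq> ?S"
    unfolding contains_proper_ap_def by blast
  define y where "y = ap_term ?G x d"
  have y: "y i j = (x j + int i * d j) mod ?m" if "j < n" for i j
    using that by (simp add: y_def ap_term_ZM_pow)
  have S: "y i \<in> ?S" if "i \<le> p ^ r" for i
    using sub that unfolding y_def by (auto simp: image_subset_iff less_Suc_eq_le)
  have q_dvd_m: "?q dvd ?m" by simp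
  \<comment> \<open>All terms have their coordinates in \<open>digits p r\<close>, where the only
    multiple of \<open>p ^ r\<close> is 0.\<close>
  have zero: "y i j = 0" if "i \<le> p ^ r" "j < n" "?q dvd x j + int i * d j" for i j
  proof -
    have "y i j \<in> digits p r"
      using S[OF that(1)] that(2) by (auto simp: digit_vectors_def)
    moreover have "?q dvd y i j"
      using that q_dvd_m by (simp only: y dvd_mod_iff)
    ultimately show ?thesis
      by (simp add: digits_def)
  qed
  \<comment> \<open>Otherwise, starting from 0, coordinate \<open>j\<close> would hit a nonzero
    multiple of \<open>p ^ r\<close> modulo \<open>p ^ Suc r\<close> at some term.\<close>
  have step: "?m dvd d j" if j: "j < n" "?m dvd x j" for j
  proof (rule ccontr)
    assume "\<not> ?m dvd d j"
    then obtain i where i: "i \<le> p ^ r" "?q dvd int i * d j" "\<not> ?m dvd int i * d j"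
      using exists_multiple_in_deleted_class[OF p] by blast
    have "?q dvd x j + int i * d j"
      using i(2) j(2) q_dvd_m by (meson dvd_add dvd_trans)
    then have "?m dvd x j + int i * d j"
      using zero[OF i(1) j(1)] y[OF j(1)] by (simp only: dvd_eq_mod_eq_0)
    then show False
      using i(3) j(2) by (simp only: dvd_add_right_iff)
  qed
  have y_0: "y 0 j = 0 \<longleftrightarrow> ?m dvd x j" if "j < n" for j
    using that by (simp only: y dvd_eq_mod_eq_0) simp
  \<comment> \<open>Properness enters only here: if \<open>p\<close> divided every coordinate of
    \<open>d\<close>, then \<open>p ^ r * d\<close> would vanish modulo \<open>p ^ Suc r\<close> and
    the first and last terms would coincide.\<close>
  obtain j where j: "j < n" "\<not> int p dvd d j"
  proof -
    have "y 0 \<noteq> y (p ^ r)"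
      using inj_onD[OF inj, of 0 "p ^ r"] prime_gt_0_nat[OF p] unfolding y_def by auto
    moreover have "y 0 = y (p ^ r)" if *: "\<And>j. j < n \<Longrightarrow> int p dvd d j"
    proof
      fix j
      show "y 0 j = y (p ^ r) j"
      proof (cases "j < n")
        case True
        then obtain c where c: "d j = int p * c" using * by blast
        have "?m dvd (x j + ?q * d j) - (x j + int 0 * d j)"
          by (simp add: c)
        then show ?thesis
          unfolding y[OF True] by (metis mod_eq_dvd_iff)
      qed (simp add: y_def ap_term_ZM_pow)
    qed
    ultimately show thesis using that by blast
  qed
  obtain i where i: "i < p ^ r" "?q dvd x j + int i * d j"
    using exists_term_dvd[OF p j(2)] by blast
  \<comment> \<open>Zeros of the first term persist by \<open>step\<close>, and \<open>j\<close> is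
    a new zero of term \<open>i\<close>, contradicting the constant count.\<close>
  have "zero_set n (y 0) \<subseteq> zero_set n (y i)"
  proof
    fix l assume "l \<in> zero_set n (y 0)"
    then have l: "l < n" "?m dvd x l"
      using y_0 by (auto simp: zero_set_def)
    then have "?m dvd x l + int i * d l"
      using step by (metis dvd_add dvd_mult)
    then have "y i l = 0"
      using l by (simp only: y dvd_eq_mod_eq_0)
    then show "l \<in> zero_set n (y i)"
      using l by (simp add: zero_set_def)
  qed
  moreover have "j \<in> zero_set n (y i)"
    using zero i j by (simp add: zero_set_def)
  moreover have "j \<notin> zero_set n (y 0)"
  proof
    assume "j \<in> zero_set n (y 0)"
    then have "?m dvd d j"
      using y_0 step j by (simp add: zero_set_def)
    moreover have "int p dvd ?m" by simp
    ultimately show False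
      using j(2) dvd_trans by blast
  qed
  ultimately have "card (zero_set n (y 0)) < card (zero_set n (y i))"
    by (intro psubset_card_mono) (auto simp: zero_set_def)
  moreover have "card (zero_set n (y 0)) = N" "card (zero_set n (y i)) = N"
    using S[of 0] S[of i] i by auto
  ultimately show False by simp
qed

lemma card_le_r_ap:
  assumes "finite (carrier G)" "S \<subseteq> carrier G" "\<not> contains_proper_ap G k S"
  shows "card S \<le> r_ap k G"
  unfolding r_ap_def
proof (rule Max_ge)
  have "{card S | S. S \<subseteq> carrier G \<and> \<not> contains_proper_ap G k S} \<subseteq> card ` Pow (carrier G)"
    by auto
  then show "finite {card S | S. S \<subseteq> carrier G \<and> \<not> contains_proper_ap G k S}"
    using assms(1) finite_subset by blast
qed (use assms in auto)

text \<open>The zero count splits the digit vectors into \<open>n + 1\<close> progression-free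
  classes, each of size at most \<open>r_ap\<close>.\<close>

lemma r_ap_prime_power_lower_bound:
  assumes p: "prime p"
  shows "(p ^ Suc r - (p - 1)) ^ n \<le> (n + 1) * r_ap (p ^ r + 1) (ZM_pow (p ^ Suc r) n)"
proof -
  let ?G = "ZM_pow (p ^ Suc r) n"
  let ?S = "\<lambda>N. {x \<in> digit_vectors p r n. card (zero_set n x) = N}"
  have p0: "p > 0" using p prime_gt_0_nat by blast
  have carrier: "carrier ?G = (\<Pi>\<^sub>E j\<in>{..<n}. {0..<int (p ^ Suc r)})"
    using p0 by (simp add: ZM_pow_def carrier_integer_mod_group)
  have vectors: "digit_vectors p r n \<subseteq> carrier ?G"
    unfolding carrier digit_vectors_def by (intro PiE_mono) (auto simp: digits_def)
  have "card (zero_set n x) \<le> n" for x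
    using card_mono[of "{..<n}" "zero_set n x"] by (auto simp: zero_set_def)
  then have "digit_vectors p r n = (\<Union>N\<in>{..n}. ?S N)"
    by auto
  then have "card (digit_vectors p r n) \<le> (\<Sum>N\<le>n. card (?S N))"
    using card_UN_le[of "{..n}" ?S] by (simp only: finite_atMost simp_thms)
  also have "\<dots> \<le> (\<Sum>N\<le>n. r_ap (p ^ r + 1) ?G)"
  proof (intro sum_mono card_le_r_ap)
    show "finite (carrier ?G)"
      unfolding carrier by (intro finite_PiE) auto
    show "?S N \<subseteq> carrier ?G" for N
      using vectors by blast
  qed (rule no_proper_ap_constant_zero_count[OF p])
  also have "\<dots> = (n + 1) * r_ap (p ^ r + 1) ?G"
    by simp
  finally show ?thesis
    by (simp add: digit_vectors_def card_PiE card_digits[OF p0])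
qed

theorem theorem3p13:
  fixes p s m k :: nat
  assumes "prime p" and "s \<ge> 2" and "m = p ^ s" and "k = p ^ (s - 1) + 1"
  shows "\<exists>C c :: real. C > 0 \<and> 0 < c \<and> c \<le> real m / 2 \<and>
           (\<forall>n::nat. n \<ge> 1 \<longrightarrow>
              real (r_ap k (ZM_pow m n)) \<ge> C * ((real m - real p + 1) ^ n / real n powr c))"
proof (intro exI conjI allI impI)
  have p2: "p \<ge> 2" using assms(1) prime_ge_2_nat by blast
  have pm: "p \<le> m"
    using assms p2 by (simp add: self_le_power)
  \<comment> \<open>This fixes the witness \<open>c = 1\<close>, admissible because
    \<open>m \<ge> p \<ge> 2\<close>.\<close>
  then show "1 \<le> real m / 2"
    using p2 by simp
  fix n :: nat assume n: "n \<ge> 1"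
  let ?A = "(real m - real p + 1) ^ n" and ?R = "real (r_ap k (ZM_pow m n))"
  have s: "Suc (s - 1) = s" using assms(2) by simp
  have "(m - (p - 1)) ^ n \<le> (n + 1) * r_ap k (ZM_pow m n)"
    using r_ap_prime_power_lower_bound[OF assms(1), of "s - 1" n] unfolding s assms(3,4) .
  then have "real ((m - (p - 1)) ^ n) \<le> real ((n + 1) * r_ap k (ZM_pow m n))"
    by (simp only: of_nat_le_iff)
  moreover have "real (m - (p - 1)) = real m - real p + 1"
    using pm p2 by (simp add: of_nat_diff)
  ultimately have "?A \<le> (real n + 1) * ?R"
    by (simp only: of_nat_power of_nat_mult of_nat_add of_nat_1)
  \<comment> \<open>The bound \<open>n + 1 \<le> 2 n\<close> for \<open>n \<ge> 1\<close> is the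
    source of the witness \<open>C = 1 / 2\<close>.\<close>
  also have "\<dots> \<le> (2 * real n) * ?R"
    using n by (intro mult_right_mono) auto
  finally show "1 / 2 * (?A / real n powr 1) \<le> ?R"
    using n by (simp add: field_simps)
qed simp_all

end
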